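(* Let $S$ be an $h$-dimensional $\mathbb{F}_q$-subspace of $\mathbb{F}_{q^n}$ such that $1\in S$ and $3\le h\le n-2$. Let $a\in\mathbb{F}_{q^n}\setminus S$, $b\in\mathbb{F}_{q^n}\setminus\mathbb{F}_q$, and $U=(S\times\{0\})\oplus\langle(1,1)\rangle_{\mathbb{F}_q}\oplus\langle(a,b)\rangle_{\mathbb{F}_q}\subseteq\mathbb{F}_{q^n}^2$. Then the set of points of weight $2$ in $L_U$ different from $\langle(1,0)\rangle_{\mathbb{F}_{q^n}}$ is $\{P_s=\langle(-s+a,b)\rangle_{\mathbb{F}_{q^n}} : s\in S\cap(a+bS)\}$, and the size of this set is $|S\cap(a+bS)|$. In particular, $L_U$ is an $h$-club of rank $h+2$ if and only if $a\notin S+bS$.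
   Context: $q$ is a prime power and $n$ a positive integer. For an $\mathbb{F}_q$-subspace $U$ of $\mathbb{F}_{q^n}^2$, $L_U=\{\langle u\rangle_{\mathbb{F}_{q^n}}: u\in U\setminus\{0\}\}\subseteq\mathrm{PG}(1,q^n)$ is an $\mathbb{F}_q$-linear set of rank $\dim_{\mathbb{F}_q}U$; the weight of $P=\langle v\rangle_{\mathbb{F}_{q^n}}$ is $w_{L_U}(P)=\dim_{\mathbb{F}_q}(U\cap\langle v\rangle_{\mathbb{F}_{q^n}})$. An $i$-club of rank $k$ is an $\mathbb{F}_q$-linear set of rank $k$ in which exactly one point has weight $i$ and all other points have weight $1$. For $b\in\mathbb{F}_{q^n}$ and a subspace $S$, $bS=\{bs:s\in S\}$, $a+bS=\{a+bs: s\in S\}$, and $S+bS$ is the sum of subspaces. *)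

theory Defs
  imports
    "HOL-Library.Set_Algebras"
    "HOL-Library.Product_Plus"
    "HOL-Library.Cardinality"
    "HOL-Number_Theory.Prime_Powers"
begin

text \<open>
  The extension of the field with \<open>q\<close> elements by the field with \<open>q ^ n\<close> elements is given by a
  field homomorphism \<open>\<phi> :: 'k \<Rightarrow> 'a\<close> (necessarily injective); the subfield is \<open>range \<phi>\<close>.
  Subspaces, spans and dimensions over \<open>'k\<close> are then those of the locale \<^locale>\<open>vector_space\<close>.
\<close>

definition field_embedding :: "('k::field \<Rightarrow> 'a::field) \<Rightarrow> bool" where
  "field_embedding \<phi> \<longleftrightarrow>
     \<phi> 1 = 1 \<and> (\<forall>x y. \<phi> (x + y) = \<phi> x + \<phi> y) \<and> (\<forall>x y. \<phi> (x * y) = \<phi> x * \<phi> y)"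

definition scale1 :: "('k::field \<Rightarrow> 'a::field) \<Rightarrow> 'k \<Rightarrow> 'a \<Rightarrow> 'a" where
  "scale1 \<phi> c x = \<phi> c * x"

definition scale2 :: "('k::field \<Rightarrow> 'a::field) \<Rightarrow> 'k \<Rightarrow> 'a \<times> 'a \<Rightarrow> 'a \<times> 'a" where
  "scale2 \<phi> c v = (\<phi> c * fst v, \<phi> c * snd v)"

lemma vector_space_scale1: "field_embedding \<phi> \<Longrightarrow> vector_space (scale1 \<phi>)"
  by unfold_locales (auto simp: field_embedding_def scale1_def algebra_simps)

lemma vector_space_scale2: "field_embedding \<phi> \<Longrightarrow> vector_space (scale2 \<phi>)"
  by unfold_locales (auto simp: field_embedding_def scale2_def algebra_simps)

lemma field_embedding_id: "field_embedding id"
  by (simp add: field_embedding_def)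

text \<open>A point of the projective line over \<open>'a\<close> is the set of vectors of a one-dimensional
  \<open>'a\<close>-subspace of \<open>'a \<times> 'a\<close>.\<close>

definition point :: "'a::field \<times> 'a \<Rightarrow> ('a \<times> 'a) set" where
  "point v = module.span (scale2 id) {v}"

definition linear_set :: "('a::field \<times> 'a) set \<Rightarrow> ('a \<times> 'a) set set" where
  "linear_set U = {point u | u. u \<in> U - {0}}"

definition weight ::
  "('k::field \<Rightarrow> 'a::field) \<Rightarrow> ('a \<times> 'a) set \<Rightarrow> ('a \<times> 'a) set \<Rightarrow> nat" where
  "weight \<phi> U P = vector_space.dim (scale2 \<phi>) (U \<inter> P)"

text \<open>Rank and weights depend on the subspace \<open>U\<close> and not only on the point set
  \<open>linear_set U\<close>, so being a club is a property of \<open>U\<close>.\<close>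

definition is_club ::
  "('k::field \<Rightarrow> 'a::field) \<Rightarrow> nat \<Rightarrow> nat \<Rightarrow> ('a \<times> 'a) set \<Rightarrow> bool" where
  "is_club \<phi> i k U \<longleftrightarrow>
     module.subspace (scale2 \<phi>) U \<and>
     vector_space.dim (scale2 \<phi>) U = k \<and>
     (\<exists>!P. P \<in> linear_set U \<and> weight \<phi> U P = i) \<and>
     (\<forall>P\<in>linear_set U. weight \<phi> U P \<noteq> i \<longrightarrow> weight \<phi> U P = 1)"

end

theory Submission
  imports Defs
begin

text \<open>
  Scaling a nonzero vector \<open>v\<close> identifies \<open>U \<inter> point v\<close> with \<open>{c. c v \<in> U}\<close>. For \<open>v = (m, 1)\<close>
  this is a subspace of the projection \<open>snd ` U\<close>, which here is the span of \<open>1\<close> and \<open>b\<close>, so the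
  weight is at most 2, with equality iff both \<open>1\<close> and \<open>b\<close> occur as scalars. As \<open>U\<close> meets
  \<open>point (1, 0)\<close> in \<open>S \<times> {0}\<close>, this happens iff \<open>m \<in> S\<close> and \<open>m b - a \<in> S\<close>; with \<open>s = a - m b\<close>
  the condition becomes \<open>s \<in> S \<inter> (a + b S)\<close>, and this intersection is empty iff
  \<open>a \<notin> S + b S\<close>.
\<close>

lemma (in finite_dimensional_vector_space) dim_eq_card_iff_basis_subset:
  assumes "independent B" "subspace T" "T \<subseteq> span B"
  shows "dim T = card B \<longleftrightarrow> B \<subseteq> T"
proof
  assume "dim T = card B"
  then have "T = span B"
    using assms by (intro subspace_dim_equal) (simp_all add: dim_eq_card_independent)
  then show "B \<subseteq> T"
    using span_superset by simp
next
  assume "B \<subseteq> T"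
  then show "dim T = card B"
    using assms by (intro dim_unique) auto
qed

lemma (in vector_space) finite_dimensional_if_finitely_spanned:
  assumes "finite A" "span A = UNIV"
  shows "finite_dimensional_vector_space scale (extend_basis {})"
proof unfold_locales
  show "independent (extend_basis {})" "span (extend_basis {}) = UNIV"
    by (simp_all add: independent_extend_basis span_extend_basis independent_empty)
  then show "finite (extend_basis {})"
    using assms independent_span_bound by blast
qed

lemma coset_Int_empty_iff:
  fixes A B :: "'a::ab_group_add set"
  assumes "\<And>x. x \<in> B \<Longrightarrow> - x \<in> B"
  shows "A \<inter> (a +o B) = {} \<longleftrightarrow> a \<notin> A + B"
proof -
  have "x \<in> a +o B \<longleftrightarrow> a \<in> x +o B" for x
    using assms[of "x - a"] assms[of "a - x"] by (auto simp flip: set_minus_plus)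
  then show ?thesis
    by (auto simp: set_plus_def elt_set_plus_def)
qed

lemma mult_in_elt_set_times_iff:
  fixes c :: "'a::division_ring"
  assumes "c \<noteq> 0"
  shows "c * x \<in> c *o A \<longleftrightarrow> x \<in> A"
  using assms by (auto simp: elt_set_times_def)

lemma point_eq_range: "point v = range (\<lambda>c. (c * fst v, c * snd v))"
proof -
  interpret vector_space "scale2 id :: 'a::field \<Rightarrow> _"
    by (rule vector_space_scale2[OF field_embedding_id])
  show ?thesis
    by (simp add: point_def span_singleton scale2_def)
qed

lemma mem_point_self: "v \<in> point v"
  by (auto simp: point_eq_range intro: range_eqI[of _ _ 1])

lemma point_scale:
  assumes "c \<noteq> 0"
  shows "point (c * x, c * y) = point (x, y)"
proof -
  have "range (\<lambda>d. (d * x, d * y)) = (\<lambda>d. (d * x, d * y)) ` range (\<lambda>d. d * c)"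
  proof -
    have "surj (\<lambda>d. d * c)"
      using assms by (intro surjI[of _ "\<lambda>d. d / c"]) simp
    then show ?thesis
      by simp
  qed
  then show ?thesis
    by (simp add: point_eq_range image_image mult.assoc)
qed

lemma point_eq_infinity:
  assumes "x \<noteq> 0"
  shows "point (x, 0) = point (1, 0)"
  using point_scale[OF assms, of 1 0] by simp

lemma point_eq_affine:
  assumes "y \<noteq> 0"
  shows "point (x, y) = point (x / y, 1)"
  using point_scale[OF assms, of "x / y" 1] assms by simp

lemma point_affine_inject: "point (m, 1) = point (m', 1) \<longleftrightarrow> m = m'"
proof
  assume "point (m, 1) = point (m', 1)"
  then have "(m, 1) \<in> point (m', 1)"
    using mem_point_self by metis
  then show "m = m'"
    by (auto simp: point_eq_range)
qed simp

lemma point_affine_neq_infinity: "point (m, 1) \<noteq> point (1, 0)"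
proof
  assume "point (m, 1) = point (1, 0)"
  then have "(m, 1) \<in> point (1, 0)"
    using mem_point_self by metis
  then show False
    by (auto simp: point_eq_range)
qed

lemma linear_set_cases:
  assumes "P \<in> linear_set U"
  obtains (infinity) "P = point (1, 0)" | (affine) m where "P = point (m, 1)"
proof -
  obtain x y where "(x, y) \<noteq> 0" "P = point (x, y)"
    using assms by (auto simp: linear_set_def)
  then show thesis
    using that point_eq_infinity[of x] point_eq_affine[of y x]
    by (cases "y = 0") (auto simp: zero_prod_def)
qed

lemma point_in_linear_set_iff_scalar:
  assumes "v \<noteq> 0"
  shows "point v \<in> linear_set U \<longleftrightarrow> (\<exists>c. c \<noteq> 0 \<and> (c * fst v, c * snd v) \<in> U)"
proof
  assume "point v \<in> linear_set U"
  then obtain u where u: "u \<in> U" "u \<noteq> 0" "point v = point u"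
    by (auto simp: linear_set_def)
  then obtain c where "u = (c * fst v, c * snd v)"
    using mem_point_self[of u] by (auto simp: point_eq_range)
  with u show "\<exists>c. c \<noteq> 0 \<and> (c * fst v, c * snd v) \<in> U"
    by (auto simp: zero_prod_def)
next
  assume "\<exists>c. c \<noteq> 0 \<and> (c * fst v, c * snd v) \<in> U"
  then obtain c where c: "c \<noteq> 0" "(c * fst v, c * snd v) \<in> U"
    by blast
  moreover have "point (c * fst v, c * snd v) = point v"
    using point_scale[OF c(1)] by simp
  moreover have "(c * fst v, c * snd v) \<noteq> 0"
    using c(1) assms by (auto simp: prod_eq_iff)
  ultimately show "point v \<in> linear_set U"
    unfolding linear_set_def by blast
qed

locale finite_extension =
  fixes \<phi> :: "'k::field \<Rightarrow> 'a::field"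
  assumes embedding: "field_embedding \<phi>"
    and finitely_spanned: "\<exists>A. finite A \<and> module.span (scale1 \<phi>) A = UNIV"
begin

sublocale V: vector_space "scale1 \<phi>"
  by (rule vector_space_scale1[OF embedding])

sublocale V2: vector_space "scale2 \<phi>"
  by (rule vector_space_scale2[OF embedding])

sublocale V12: vector_space_pair "scale1 \<phi>" "scale2 \<phi>" ..

sublocale V21: vector_space_pair "scale2 \<phi>" "scale1 \<phi>" ..

lemma linear_scale_vector: "Vector_Spaces.linear (scale1 \<phi>) (scale2 \<phi>) (\<lambda>c. (c * x, c * y))"
  by unfold_locales (auto simp: scale1_def scale2_def algebra_simps)

lemma linear_snd: "Vector_Spaces.linear (scale2 \<phi>) (scale1 \<phi>) snd"
  by unfold_locales (auto simp: scale1_def scale2_def)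

sublocale V: finite_dimensional_vector_space "scale1 \<phi>" "V.extend_basis {}"
  using finitely_spanned by (auto intro: V.finite_dimensional_if_finitely_spanned)

lemma finitely_spanned_prod: "\<exists>A. finite A \<and> V2.span A = UNIV"
proof -
  obtain A where A: "finite A" "V.span A = UNIV"
    using finitely_spanned by blast
  have span_axis: "V2.span ((\<lambda>c. (c * x, c * y)) ` A) = range (\<lambda>c. (c * x, c * y))" for x y
    unfolding V12.linear_span_image[OF linear_scale_vector] A(2) by (rule refl)
  define G where "G = (\<lambda>c. (c * 1, c * 0)) ` A \<union> (\<lambda>c. (c * 0, c * 1)) ` A"
  have "v \<in> V2.span G" for v
  proof -
    have "v = (fst v * 1, fst v * 0) + (snd v * 0, snd v * 1)"
      by simp
    then show ?thesis
      unfolding G_def V2.span_Un span_axis by blast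
  qed
  then have "V2.span G = UNIV"
    by auto
  moreover have "finite G"
    using A(1) by (simp add: G_def)
  ultimately show ?thesis
    by (intro exI[of _ G] conjI)
qed

sublocale V2: finite_dimensional_vector_space "scale2 \<phi>" "V2.extend_basis {}"
  using finitely_spanned_prod by (auto intro: V2.finite_dimensional_if_finitely_spanned)

sublocale V12: finite_dimensional_vector_space_pair_1 "scale1 \<phi>" "V.extend_basis {}" "scale2 \<phi>" ..

lemma dim_scale_vector_image:
  assumes "v \<noteq> 0"
  shows "V2.dim ((\<lambda>c. (c * fst v, c * snd v)) ` C) = V.dim C"
  using assms
  by (intro V12.dim_image_eq linear_scale_vector) (auto simp: inj_on_def prod_eq_iff)

lemma weight_point:
  assumes "v \<noteq> 0"
  shows "weight \<phi> U (point v) = V.dim {c. (c * fst v, c * snd v) \<in> U}"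
proof -
  have "U \<inter> point v = (\<lambda>c. (c * fst v, c * snd v)) ` {c. (c * fst v, c * snd v) \<in> U}"
    by (auto simp: point_eq_range)
  then show ?thesis
    by (simp add: weight_def dim_scale_vector_image[OF assms])
qed

lemma point_in_linear_set_iff:
  assumes "v \<noteq> 0"
  shows "point v \<in> linear_set U \<longleftrightarrow> weight \<phi> U (point v) > 0"
proof -
  have "point v \<in> linear_set U \<longleftrightarrow> \<not> {c. (c * fst v, c * snd v) \<in> U} \<subseteq> {0}"
    unfolding point_in_linear_set_iff_scalar[OF assms] by blast
  also have "\<dots> \<longleftrightarrow> weight \<phi> U (point v) > 0"
    unfolding weight_point[OF assms] by (simp flip: V.dim_eq_0)
  finally show ?thesis .
qed

lemma weight_pos:
  assumes "P \<in> linear_set U"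
  shows "weight \<phi> U P > 0"
proof -
  obtain u where "u \<noteq> 0" "P = point u"
    using assms by (auto simp: linear_set_def)
  then show ?thesis
    using assms point_in_linear_set_iff by blast
qed

lemma
  assumes "V2.subspace U" "V.independent B" "snd ` U \<subseteq> V.span B"
  shows weight_affine_le: "weight \<phi> U (point (m, 1)) \<le> card B"
    and weight_affine_eq_card_iff:
      "weight \<phi> U (point (m, 1)) = card B \<longleftrightarrow> (\<forall>t\<in>B. (t * m, t) \<in> U)"
proof -
  define T where "T = {t. (t * m, t) \<in> U}"
  have weight: "weight \<phi> U (point (m, 1)) = V.dim T"
    by (subst weight_point) (simp_all add: T_def zero_prod_def)
  have T_span: "T \<subseteq> V.span B"
    using assms(3) by (force simp: T_def)
  have "V.subspace ((\<lambda>t. (t * m, t * 1)) -` U)"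
    by (rule V12.linear_subspace_vimage[OF linear_scale_vector assms(1)])
  then have T: "V.subspace T"
    by (simp add: T_def vimage_def)
  show "weight \<phi> U (point (m, 1)) \<le> card B"
    unfolding weight using T_span V.finiteI_independent[OF assms(2)] by (rule V.dim_le_card)
  show "weight \<phi> U (point (m, 1)) = card B \<longleftrightarrow> (\<forall>t\<in>B. (t * m, t) \<in> U)"
    unfolding weight V.dim_eq_card_iff_basis_subset[OF assms(2) T T_span] by (auto simp: T_def)
qed

lemma is_club_iff_no_weight_2_points:
  assumes "V2.subspace U" "V2.dim U = k" "Q \<in> linear_set U" "weight \<phi> U Q = i" "i > 2"
    and weight_le: "\<And>P. P \<in> linear_set U \<Longrightarrow> P \<noteq> Q \<Longrightarrow> weight \<phi> U P \<le> 2"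
  shows "is_club \<phi> i k U \<longleftrightarrow> {P \<in> linear_set U. weight \<phi> U P = 2 \<and> P \<noteq> Q} = {}"
proof -
  have weight_eq_iff: "weight \<phi> U P = i \<longleftrightarrow> P = Q" if "P \<in> linear_set U" for P
    using weight_le[OF that] assms(4,5) by force
  then have "is_club \<phi> i k U \<longleftrightarrow> (\<forall>P\<in>linear_set U. P \<noteq> Q \<longrightarrow> weight \<phi> U P = 1)"
    using assms(1-3) by (auto simp: is_club_def)
  moreover have "weight \<phi> U P = 1 \<longleftrightarrow> weight \<phi> U P \<noteq> 2"
    if "P \<in> linear_set U" "P \<noteq> Q" for P
    using weight_le[OF that] weight_pos[OF that(1)] by linarith
  ultimately show ?thesis
    by blast
qed

end

lemma finite_extension_of_finite_field:
  fixes \<phi> :: "'k::field \<Rightarrow> 'a::{field,finite}"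
  assumes "field_embedding \<phi>"
  shows "finite_extension \<phi>"
proof -
  interpret vector_space "scale1 \<phi>"
    by (rule vector_space_scale1[OF assms])
  show ?thesis
    using assms span_UNIV finite[of "UNIV :: 'a set"] by unfold_locales blast+
qed

locale club_construction = finite_extension \<phi>
  for \<phi> :: "'k::field \<Rightarrow> 'a::field" +
  fixes S :: "'a set" and a b :: 'a and U :: "('a \<times> 'a) set"
  assumes subspace_S: "V.subspace S"
    and one_in_S: "1 \<in> S"
    and b_notin_range: "b \<notin> range \<phi>"
    and U_eq: "U = (S \<times> {0}) + V2.span {(1, 1)} + V2.span {(a, b)}"
begin

lemma b_notin_span_1: "b \<notin> V.span {1}"
  using b_notin_range by (auto simp: V.span_singleton scale1_def)

lemma b_neq_0: "b \<noteq> 0"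
  using b_notin_span_1 V.span_zero by blast

lemma b_neq_1: "b \<noteq> 1"
  using b_notin_span_1 V.span_base by blast

lemma independent_b_1: "V.independent {b, 1}"
  using b_notin_span_1 by (intro V.independent_insertI V.independent_empty) simp_all

lemma card_b_1: "card {b, 1} = 2"
  using b_neq_1 by simp

lemma neg_in_S_iff: "- x \<in> S \<longleftrightarrow> x \<in> S"
  using V.subspace_neg[OF subspace_S, of x] V.subspace_neg[OF subspace_S, of "- x"] by auto

lemma span_S_times_0: "V2.span (S \<times> {0}) = S \<times> {0}"
proof -
  have "V2.subspace (S \<times> {0})"
    using subspace_S
    by (auto simp: V.subspace_def V2.subspace_def scale1_def scale2_def zero_prod_def)
  then show ?thesis
    by simp
qed

lemma U_eq_span: "U = V2.span (insert (a, b) (insert (1, 1) (S \<times> {0})))"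
proof -
  have "V2.span A + V2.span B = V2.span (A \<union> B)" for A B
    unfolding V2.span_Un set_plus_def by blast
  then have "U = V2.span ((S \<times> {0} \<union> {(1, 1)}) \<union> {(a, b)})"
    unfolding U_eq by (metis span_S_times_0)
  then show ?thesis
    by (simp add: insert_commute)
qed

lemma subspace_U: "V2.subspace U"
  by (simp add: U_eq_span)

lemma snd_U: "snd ` U = V.span {b, 1}"
proof -
  have "snd ` (insert (a, b) (insert (1, 1) (S \<times> {0}))) = insert 0 {b, 1}"
    using one_in_S by force
  then show ?thesis
    unfolding U_eq_span
    by (metis V21.linear_span_image[OF linear_snd] V.span_insert_0)
qed

lemma dim_S_times_0: "V2.dim (S \<times> {0}) = V.dim S"
proof -
  have "S \<times> {0} = (\<lambda>c. (c * fst (1, 0), c * snd (1, 0))) ` S"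
    by auto
  then show ?thesis
    using dim_scale_vector_image[of "(1, 0)" S] by (simp add: zero_prod_def)
qed

lemma dim_U: "V2.dim U = V.dim S + 2"
proof -
  have "(1, 1) \<notin> V2.span (S \<times> {0})"
    unfolding span_S_times_0 by simp
  moreover have "(a, b) \<notin> V2.span (insert (1, 1) (S \<times> {0}))"
    using b_notin_range by (auto simp: V2.span_insert span_S_times_0 scale2_def)
  ultimately show ?thesis
    by (simp add: U_eq_span V2.dim_insert dim_S_times_0)
qed

lemma horizontal_in_U_iff: "(x, 0) \<in> U \<longleftrightarrow> x \<in> S"
proof
  assume "(x, 0) \<in> U"
  then obtain k l where kl: "(x, 0) - scale2 \<phi> k (a, b) - scale2 \<phi> l (1, 1) \<in> S \<times> {0}"
    unfolding U_eq_span V2.span_breakdown_eq span_S_times_0 by metis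
  then have "scale1 \<phi> k b + scale1 \<phi> l 1 = 0"
    by (auto simp: scale1_def scale2_def mult.commute neg_eq_iff_add_eq_0)
  then have "(\<Sum>v\<in>{b, 1}. scale1 \<phi> (if v = b then k else l) v) = 0"
    using b_neq_1 by auto
  then have "(if v = b then k else l) = 0" if "v \<in> {b, 1}" for v
    using V.independentD[OF independent_b_1 _ subset_refl, of "\<lambda>v. if v = b then k else l" v] that
    by simp
  from this[of b] this[of 1] have "k = 0" "l = 0"
    using b_neq_1 by simp_all
  with kl show "x \<in> S"
    by simp
next
  assume "x \<in> S"
  then show "(x, 0) \<in> U"
    unfolding U_eq_span by (intro V2.span_base) simp
qed

lemma weight_infinity: "weight \<phi> U (point (1, 0)) = V.dim S"
  by (subst weight_point) (simp_all add: horizontal_in_U_iff zero_prod_def)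

lemma infinity_in_linear_set: "point (1, 0) \<in> linear_set U"
  using one_in_S unfolding horizontal_in_U_iff[symmetric]
  by (force simp: linear_set_def zero_prod_def)

lemma in_U_iff_diff_in_S:
  assumes "(x', y) \<in> U"
  shows "(x, y) \<in> U \<longleftrightarrow> x - x' \<in> S"
  using assms V2.span_add_eq2[of "(x', y)" _ "(x - x', 0)"]
  unfolding horizontal_in_U_iff[symmetric] U_eq_span by simp

lemma weight_affine_le_2: "weight \<phi> U (point (m, 1)) \<le> 2"
  using weight_affine_le[OF subspace_U independent_b_1] by (simp add: snd_U card_b_1)

lemma weight_affine_eq_2_iff: "weight \<phi> U (point (m, 1)) = 2 \<longleftrightarrow> m \<in> S \<and> m * b - a \<in> S"
proof -
  have generators: "(1, 1) \<in> U" "(a, b) \<in> U"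
    by (simp_all add: U_eq_span V2.span_base)
  have "weight \<phi> U (point (m, 1)) = 2 \<longleftrightarrow> (m, 1) \<in> U \<and> (m * b, b) \<in> U"
    using weight_affine_eq_card_iff[OF subspace_U independent_b_1]
    by (auto simp: snd_U card_b_1 mult.commute)
  also have "\<dots> \<longleftrightarrow> m - 1 \<in> S \<and> m * b - a \<in> S"
    using generators[THEN in_U_iff_diff_in_S] by simp
  also have "m - 1 \<in> S \<longleftrightarrow> m \<in> S"
    using V.subspace_add[OF subspace_S _ one_in_S, of "m - 1"]
      V.subspace_diff[OF subspace_S _ one_in_S] by auto
  finally show ?thesis .
qed

lemma weight_point_b_eq_2_iff:
  "weight \<phi> U (point (- s + a, b)) = 2 \<longleftrightarrow> s \<in> S \<inter> (a +o (b *o S))"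
proof -
  define m where "m = (- s + a) / b"
  have s: "s = a - m * b"
    using b_neq_0 by (simp add: m_def)
  have "s \<in> a +o (b *o S) \<longleftrightarrow> b * - m \<in> b *o S"
    by (simp add: s mult.commute flip: set_minus_plus)
  also have "\<dots> \<longleftrightarrow> - m \<in> S"
    by (rule mult_in_elt_set_times_iff[OF b_neq_0])
  also have "\<dots> \<longleftrightarrow> m \<in> S"
    by (rule neg_in_S_iff)
  finally have "s \<in> a +o (b *o S) \<longleftrightarrow> m \<in> S" .
  moreover have "s \<in> S \<longleftrightarrow> m * b - a \<in> S"
    using neg_in_S_iff[of s] by (simp add: s)
  ultimately show ?thesis
    using weight_affine_eq_2_iff by (auto simp: point_eq_affine[OF b_neq_0] m_def)
qed

lemma weight_2_points:
  "{P \<in> linear_set U. weight \<phi> U P = 2 \<and> P \<noteq> point (1, 0)} =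
     {point (- s + a, b) | s. s \<in> S \<inter> (a +o (b *o S))}"
  (is "?L = ?R")
proof (intro equalityI subsetI)
  fix P assume P: "P \<in> ?L"
  then obtain m where "P = point (m, 1)"
    by (auto elim: linear_set_cases)
  then have "P = point (- (a - m * b) + a, b)"
    using b_neq_0 by (simp add: point_eq_affine[OF b_neq_0])
  with P show "P \<in> ?R"
    using weight_point_b_eq_2_iff by blast
next
  fix P assume "P \<in> ?R"
  then obtain s where P: "P = point (- s + a, b)" and weight: "weight \<phi> U P = 2"
    using weight_point_b_eq_2_iff by blast
  have "P \<in> linear_set U"
    using weight b_neq_0 unfolding P by (subst point_in_linear_set_iff) (auto simp: zero_prod_def)
  moreover have "P \<noteq> point (1, 0)"
    unfolding P point_eq_affine[OF b_neq_0] by (rule point_affine_neq_infinity)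
  ultimately show "P \<in> ?L"
    using weight by simp
qed

lemma card_weight_2_points:
  "card {P \<in> linear_set U. weight \<phi> U P = 2 \<and> P \<noteq> point (1, 0)} = card (S \<inter> (a +o (b *o S)))"
proof -
  have "inj_on (\<lambda>s. point (- s + a, b)) (S \<inter> (a +o (b *o S)))"
    using b_neq_0 by (simp add: inj_on_def point_eq_affine[OF b_neq_0] point_affine_inject)
  from card_image[OF this] show ?thesis
    unfolding weight_2_points Setcompr_eq_image .
qed

lemma is_club_iff:
  assumes "V.dim S \<ge> 3"
  shows "is_club \<phi> (V.dim S) (V.dim S + 2) U \<longleftrightarrow> a \<notin> S + (b *o S)"
proof -
  have "weight \<phi> U P \<le> 2" if "P \<in> linear_set U" "P \<noteq> point (1, 0)" for P
    using that by (cases rule: linear_set_cases) (simp_all add: weight_affine_le_2)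
  then have "is_club \<phi> (V.dim S) (V.dim S + 2) U \<longleftrightarrow>
      {P \<in> linear_set U. weight \<phi> U P = 2 \<and> P \<noteq> point (1, 0)} = {}"
    using assms
    by (intro is_club_iff_no_weight_2_points subspace_U dim_U infinity_in_linear_set
        weight_infinity) simp_all
  also have "\<dots> \<longleftrightarrow> S \<inter> (a +o (b *o S)) = {}"
    unfolding weight_2_points by blast
  also have "\<dots> \<longleftrightarrow> a \<notin> S + (b *o S)"
  proof (rule coset_Int_empty_iff)
    fix x assume "x \<in> b *o S"
    then obtain t where "t \<in> S" "x = b * t"
      by (auto simp: elt_set_times_def)
    then show "- x \<in> b *o S"
      using mult_in_elt_set_times_iff[OF b_neq_0, of "- t"] neg_in_S_iff[of t] by simp
  qed
  finally show ?thesis .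
qed

end

theorem theorem3p2:
  fixes \<phi> :: "'k::{field,finite} \<Rightarrow> 'a::{field,finite}"
    and q n h :: nat
    and S :: "'a set"
    and a b :: 'a
    and U :: "('a \<times> 'a) set"
  assumes "primepow q" and "n > 0"
    and "CARD('k) = q" and "CARD('a) = q ^ n"
    and "field_embedding \<phi>"
    and "module.subspace (scale1 \<phi>) S"
    and "vector_space.dim (scale1 \<phi>) S = h"
    and "1 \<in> S"
    and "3 \<le> h" and "h + 2 \<le> n"
    and "a \<notin> S"
    and "b \<notin> range \<phi>"
    and "U = (S \<times> {0}) + module.span (scale2 \<phi>) {(1, 1)} + module.span (scale2 \<phi>) {(a, b)}"
  shows "{P \<in> linear_set U. weight \<phi> U P = 2 \<and> P \<noteq> point (1, 0)} =
           {point (- s + a, b) | s. s \<in> S \<inter> (a +o (b *o S))} \<and>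
         card {P \<in> linear_set U. weight \<phi> U P = 2 \<and> P \<noteq> point (1, 0)} =
           card (S \<inter> (a +o (b *o S))) \<and>
         (is_club \<phi> h (h + 2) U \<longleftrightarrow> a \<notin> S + (b *o S))"
proof -
  interpret club_construction \<phi> S a b U
    using finite_extension_of_finite_field[OF assms(5)] assms(6,8,12,13)
    by (simp add: club_construction_def club_construction_axioms_def)
  show ?thesis
    using weight_2_points card_weight_2_points is_club_iff assms(7,9) by blast
qed

end
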